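(* Let $0<\alpha\le1$ and let $f=h+\overline{g}\in\mathcal{W}^0_{\mathcal{H}}(\alpha)$ with $h(z)=z+\sum_{n=2}^\infty a_nz^n$ and $g(z)=\sum_{n=2}^\infty b_nz^n$. Then for all $z\in\mathbb{D}$, $$|z|+2\sum_{n=2}^\infty\frac{(-1)^{n-1}|z|^n}{\alpha n^2+n(1-\alpha)}\le|f(z)|\le|z|+2\sum_{n=2}^\infty\frac{|z|^n}{\alpha n^2+n(1-\alpha)}.$$ This result is sharp for the function $f(z)=z+\sum_{n=2}^\infty\frac{2}{\alpha n^2+n(1-\alpha)}z^n$ and its rotations.
   Context: $\mathbb{D}=\{z\in\mathbb{C}:|z|<1\}$. $\mathcal{H}$ is the class of complex-valued harmonic functions $f$ in $\mathbb{D}$ with $f(0)=0$ and $f_z(0)=1$; each has the canonical representation $f=h+\overline{g}$ with $h(z)=z+\sum_{n\ge2}a_nz^n$ and $g(z)=\sum_{n\ge1}b_nz^n$ analytic in $\mathbb{D}$. For $\alpha\ge0$, $\mathcal{W}^0_{\mathcal{H}}(\alpha)$ is the class of $f=h+\overline{g}\in\mathcal{H}$ with $g'(0)=0$ and $\mathrm{Re}(h'(z)+\alpha zh''(z))>|g'(z)+\alpha zg''(z)|$ for all $z\in\mathbb{D}$. Rotations of $f$ are the functions $e^{-i\theta}f(e^{i\theta}z)$, $\theta\in\mathbb{R}$; sharp means that these functions belong to the class and equality in the bounds is attained by them. *)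

theory Defs
  imports "HOL-Complex_Analysis.Complex_Analysis"
begin

abbreviation unit_disc :: "complex set"
  where "unit_disc \<equiv> ball 0 1"

definition pdx :: "(complex \<Rightarrow> complex) \<Rightarrow> complex \<Rightarrow> complex"
  where "pdx f z = vector_derivative (\<lambda>t::real. f (z + of_real t)) (at 0)"

definition pdy :: "(complex \<Rightarrow> complex) \<Rightarrow> complex \<Rightarrow> complex"
  where "pdy f z = vector_derivative (\<lambda>t::real. f (z + \<i> * of_real t)) (at 0)"

(* Here "differentiable_on" is real (Frechet) differentiability, not complex differentiability.
   It ensures that the partial derivatives, as values of the total operator vector_derivative,
   are genuine on the open set S. *)
definition C2_on :: "(complex \<Rightarrow> complex) \<Rightarrow> complex set \<Rightarrow> bool"
  where "C2_on f S \<longleftrightarrow>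
    f differentiable_on S \<and> pdx f differentiable_on S \<and> pdy f differentiable_on S \<and>
    continuous_on S (pdx (pdx f)) \<and> continuous_on S (pdx (pdy f)) \<and>
    continuous_on S (pdy (pdx f)) \<and> continuous_on S (pdy (pdy f))"

definition complex_harmonic_on :: "(complex \<Rightarrow> complex) \<Rightarrow> complex set \<Rightarrow> bool"
  where "complex_harmonic_on f S \<longleftrightarrow>
    open S \<and> C2_on f S \<and> (\<forall>z\<in>S. pdx (pdx f) z + pdy (pdy f) z = 0)"

definition wirtinger_z :: "(complex \<Rightarrow> complex) \<Rightarrow> complex \<Rightarrow> complex"
  where "wirtinger_z f z = (pdx f z - \<i> * pdy f z) / 2"

(* Functions are total on the complex plane; only their values on the disc matter. *)
definition class_H :: "(complex \<Rightarrow> complex) set"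
  where "class_H = {f. complex_harmonic_on f unit_disc \<and> f 0 = 0 \<and> wirtinger_z f 0 = 1}"

(* The normalisations say that the Taylor series of h and g at 0 have the form
   h(z) = z + a_2 z^2 + ... and g(z) = b_1 z + b_2 z^2 + ...; they make (h, g) unique on the disc. *)
definition canonical_rep ::
    "(complex \<Rightarrow> complex) \<Rightarrow> (complex \<Rightarrow> complex) \<Rightarrow> (complex \<Rightarrow> complex) \<Rightarrow> bool"
  where "canonical_rep f h g \<longleftrightarrow>
    h holomorphic_on unit_disc \<and> g holomorphic_on unit_disc \<and>
    h 0 = 0 \<and> deriv h 0 = 1 \<and> g 0 = 0 \<and>
    (\<forall>z\<in>unit_disc. f z = h z + cnj (g z))"

definition class_W0 :: "real \<Rightarrow> (complex \<Rightarrow> complex) set"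
  where "class_W0 \<alpha> = {f \<in> class_H. \<exists>h g. canonical_rep f h g \<and> deriv g 0 = 0 \<and>
    (\<forall>z\<in>unit_disc. Re (deriv h z + of_real \<alpha> * z * deriv (deriv h) z)
                    > cmod (deriv g z + of_real \<alpha> * z * deriv (deriv g) z))}"

definition growth_lower :: "real \<Rightarrow> real \<Rightarrow> real"
  where "growth_lower \<alpha> r =
    r + 2 * (\<Sum>\<^sub>\<infinity>n\<in>{2..}. (-1) ^ (n - 1) * r ^ n / (\<alpha> * (real n)\<^sup>2 + real n * (1 - \<alpha>)))"

definition growth_upper :: "real \<Rightarrow> real \<Rightarrow> real"
  where "growth_upper \<alpha> r =
    r + 2 * (\<Sum>\<^sub>\<infinity>n\<in>{2..}. r ^ n / (\<alpha> * (real n)\<^sup>2 + real n * (1 - \<alpha>)))"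

definition extremal :: "real \<Rightarrow> complex \<Rightarrow> complex"
  where "extremal \<alpha> z =
    z + (\<Sum>\<^sub>\<infinity>n\<in>{2..}. of_real (2 / (\<alpha> * (real n)\<^sup>2 + real n * (1 - \<alpha>))) * z ^ n)"

definition rotation :: "real \<Rightarrow> (complex \<Rightarrow> complex) \<Rightarrow> complex \<Rightarrow> complex"
  where "rotation \<theta> f z = exp (- \<i> * of_real \<theta>) * f (exp (\<i> * of_real \<theta>) * z)"

end

theory Submission
  imports Defs
begin

text \<open>
  For a unimodular \<open>\<epsilon>\<close> put \<open>F = h + \<epsilon> g\<close>. The function \<open>P(z) = F'(z) + \<alpha> z F''(z)\<close> has positive real
  part and \<open>P(0) = 1\<close>, so by the Schwarz lemma \<open>Re P\<close> and \<open>|P|\<close> are controlled by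
  \<open>(1 - |z|) / (1 + |z|)\<close> and \<open>(1 + |z|) / (1 - |z|)\<close>. The extremal function \<open>E\<close> satisfies
  \<open>E'(z) + \<alpha> z E''(z) = (1 + z) / (1 - z)\<close>, and the growth functions at \<open>r\<close> are \<open>-E(-r)\<close> and \<open>E(r)\<close>.
  Along a ray, \<open>X' + \<alpha> t X'' \<ge> 0\<close> says that \<open>t powr (1/\<alpha>) * X'\<close> is nondecreasing, so these bounds for \<open>P\<close>
  integrate to bounds for \<open>F\<close>. Choosing \<open>\<epsilon>\<close> so that \<open>\<epsilon> g(z)\<close> has a suitable argument yields bounds for
  \<open>|h(z)| - |g(z)|\<close> and \<open>|h(z)| + |g(z)|\<close>.
\<close>

section \<open>Holomorphic functions as harmonic functions in real partial derivatives\<close>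

text \<open>Agreement of \<open>f\<close> and \<open>G\<close> is asked for on \<open>S\<close>
  only, so that the lemma can be applied again to \<open>pdx f\<close> and \<open>pdy f\<close>,
  which are identified with holomorphic functions only there.\<close>

lemma holomorphic_pdx_pdy:
  assumes "open S" "G holomorphic_on S" "\<And>w. w \<in> S \<Longrightarrow> f w = G w" "z \<in> S"
  shows "pdx f z = deriv G z" "pdy f z = \<i> * deriv G z"
proof -
  have line: "vector_derivative (\<lambda>t::real. f (z + c * of_real t)) (at 0) = c * deriv G z" for c
  proof -
    have G: "(G has_field_derivative deriv G z) (at (z + c * of_real 0))"
      using assms(1,2,4) by (simp add: holomorphic_derivI)
    have "((\<lambda>t::real. z + c * of_real t) has_vector_derivative c) (at 0)"
      by (auto intro!: derivative_eq_intros)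
    from field_vector_diff_chain_at[OF this G]
    have D: "((\<lambda>t::real. G (z + c * of_real t)) has_vector_derivative c * deriv G z) (at 0)"
      by (simp add: o_def)
    have "open ((\<lambda>t::real. z + c * of_real t) -` S)"
      by (intro open_vimage \<open>open S\<close> continuous_intros)
    then have "((\<lambda>t::real. f (z + c * of_real t)) has_vector_derivative c * deriv G z) (at 0)"
      by (rule has_vector_derivative_transform_within_open[OF D]) (use assms in auto)
    then show ?thesis by (rule vector_derivative_at)
  qed
  show "pdx f z = deriv G z" using line[of 1] by (simp add: pdx_def)
  show "pdy f z = \<i> * deriv G z" using line[of \<i>] by (simp add: pdy_def)
qed

text \<open>This places the rotated extremal functions in \<open>class_H\<close>. The second
  partials are f'' and i^2 f'' = -f'', which cancel.\<close>

lemma holomorphic_imp_complex_harmonic_on: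
  assumes S: "open S" and f: "f holomorphic_on S"
  shows "complex_harmonic_on f S"
proof -
  have d: "deriv f holomorphic_on S" "(\<lambda>z. \<i> * deriv f z) holomorphic_on S"
    using f S by (auto intro!: holomorphic_intros)
  have dd: "deriv (deriv f) holomorphic_on S"
    using d S by (auto intro!: holomorphic_intros)
  have x: "pdx f z = deriv f z" and y: "pdy f z = \<i> * deriv f z" if "z \<in> S" for z
    using holomorphic_pdx_pdy[OF S f _ that] by auto
  have i: "deriv (\<lambda>z. \<i> * deriv f z) z = \<i> * deriv (deriv f) z" if "z \<in> S" for z
    by (rule deriv_cmult) (meson that S d(1) holomorphic_on_imp_differentiable_at)
  have xx: "pdx (pdx f) z = deriv (deriv f) z" "pdy (pdx f) z = \<i> * deriv (deriv f) z"
    if "z \<in> S" for z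
    using holomorphic_pdx_pdy[OF S d(1) x that] by auto
  have yy: "pdx (pdy f) z = \<i> * deriv (deriv f) z" "pdy (pdy f) z = - deriv (deriv f) z"
    if "z \<in> S" for z
    using holomorphic_pdx_pdy[OF S d(2) y that] i[OF that] by auto
  have diff: "g differentiable_on S" if "G holomorphic_on S" "\<And>z. z \<in> S \<Longrightarrow> g z = G z" for g G
  proof -
    have "G differentiable_on S" unfolding differentiable_on_def
    proof
      fix z assume "z \<in> S"
      then have "(G has_field_derivative deriv G z) (at z)"
        using that(1) S by (simp add: holomorphic_derivI)
      then show "G differentiable at z within S"
        by (meson differentiableI differentiable_at_withinI has_field_derivative_imp_has_derivative)
    qed
    then show ?thesis using that(2) by (simp add: differentiable_on_def differentiable_def)
        (metis has_derivative_transform)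
  qed
  have c: "continuous_on S (deriv (deriv f))" using dd by (rule holomorphic_on_imp_continuous_on)
  have "C2_on f S" unfolding C2_on_def
  proof (intro conjI)
    show "f differentiable_on S" using diff[OF f] by simp
    show "pdx f differentiable_on S" using diff[OF d(1)] x by simp
    show "pdy f differentiable_on S" using diff[OF d(2)] y by simp
    show "continuous_on S (pdx (pdx f))" using c xx by simp
    show "continuous_on S (pdx (pdy f))"
      using continuous_on_mult[OF continuous_on_const[of S \<i>] c] yy by simp
    show "continuous_on S (pdy (pdx f))"
      using continuous_on_mult[OF continuous_on_const[of S \<i>] c] xx by simp
    show "continuous_on S (pdy (pdy f))"
      using continuous_on_minus[OF c] yy by simp
  qed
  then show ?thesis
    using S xx yy by (simp add: complex_harmonic_on_def)
qed

section \<open>Functions with positive real part\<close>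

text \<open>The Cayley transform \<open>Q\<close> of \<open>P\<close> maps the disc into itself and
  fixes 0, so the Schwarz lemma gives |Q(z)| <= |z|. Solving for \<open>P\<close> turns this into
  both bounds.\<close>

lemma Caratheodory_bounds:
  assumes P: "P holomorphic_on ball 0 1" and re: "\<And>z. cmod z < 1 \<Longrightarrow> Re (P z) > 0"
    and P0: "P 0 = 1" and z: "cmod z < 1"
  shows "Re (P z) \<ge> (1 - cmod z) / (1 + cmod z)" "cmod (P z) \<le> (1 + cmod z) / (1 - cmod z)"
proof -
  define Q where "Q = (\<lambda>z. (P z - 1) / (P z + 1))"
  have nz: "P w + 1 \<noteq> 0" if "cmod w < 1" for w
    using re[OF that] by (auto simp: complex_eq_iff)
  have Q: "Q holomorphic_on ball 0 1" unfolding Q_def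
    using nz by (intro holomorphic_intros P) auto
  have lt: "cmod (Q w) < 1" if "cmod w < 1" for w
  proof -
    \<comment> \<open>The difference of the two squares is 4 Re P(w).\<close>
    have "(cmod (P w - 1))\<^sup>2 < (cmod (P w + 1))\<^sup>2"
      using re[OF that] unfolding cmod_power2 by (simp add: power2_eq_square algebra_simps)
    then have "cmod (P w - 1) < cmod (P w + 1)" by (rule power_less_imp_less_base) simp
    then show ?thesis using nz[OF that] by (simp add: Q_def norm_divide)
  qed
  define q where "q = cmod (Q z)"
  have qz: "q \<le> cmod z"
    using Schwarz_Lemma(1)[OF Q _ lt z] P0 by (simp add: Q_def q_def)
  have q1: "0 \<le> q" "q < 1" using qz z by (auto simp: q_def)
  have "1 - Q z = 2 / (P z + 1)" using nz[OF z] by (simp add: Q_def field_simps)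
  then have nz1: "1 - Q z \<noteq> 0" using nz[OF z] by simp
  have PQ: "P z = (1 + Q z) / (1 - Q z)"
  proof -
    have "1 + Q z = 2 * P z / (P z + 1)" using nz[OF z] by (simp add: Q_def field_simps)
    with \<open>1 - Q z = _\<close> show ?thesis using nz[OF z] by simp
  qed
  have up: "cmod (1 - Q z) \<le> 1 + q" and low: "1 - q \<le> cmod (1 - Q z)"
    using norm_triangle_ineq4[of 1 "Q z"] norm_triangle_ineq2[of 1 "Q z"] by (auto simp: q_def)
  \<comment> \<open>This is Re((1 + Q) / (1 - Q)) = (1 - |Q|^2) / |1 - Q|^2, whose denominator is at
    most (1 + q)^2.\<close>
  have "Re (P z) = (1 - q\<^sup>2) / (cmod (1 - Q z))\<^sup>2"
    unfolding PQ q_def Re_divide cmod_power2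
    by (rule arg_cong2[where f="(/)"]) (simp_all add: power2_eq_square algebra_simps)
  moreover have "(1 - q\<^sup>2) / (1 + q)\<^sup>2 \<le> (1 - q\<^sup>2) / (cmod (1 - Q z))\<^sup>2"
    using up q1 nz1 by (intro divide_left_mono power_mono mult_pos_pos) (auto simp: power_le_one)
  moreover have "(1 - q\<^sup>2) / (1 + q)\<^sup>2 = (1 - q) / (1 + q)"
  proof -
    have "1 - q\<^sup>2 = (1 - q) * (1 + q)" by (simp add: power2_eq_square algebra_simps)
    then show ?thesis using q1 by (simp add: power2_eq_square)
  qed
  moreover have "(1 - cmod z) / (1 + cmod z) \<le> (1 - q) / (1 + q)"
    using qz q1 z by (intro frac_le) auto
  ultimately show "Re (P z) \<ge> (1 - cmod z) / (1 + cmod z)" by linarith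
  have "cmod (P z) \<le> (1 + q) / (1 - q)"
    unfolding PQ norm_divide using low q1 norm_triangle_ineq[of 1 "Q z"]
    by (intro frac_le) (auto simp: q_def)
  also have "\<dots> \<le> (1 + cmod z) / (1 - cmod z)"
    using qz q1 z by (intro frac_le) auto
  finally show "cmod (P z) \<le> (1 + cmod z) / (1 - cmod z)" .
qed

section \<open>Comparison along rays\<close>

text \<open>The integrating factor \<open>t powr (1/\<alpha>)\<close> makes the derivative of
  \<open>t powr (1/\<alpha>) * x t\<close> a positive multiple of
  \<open>x t + \<alpha> * t * y t\<close>. Monotonicity gives first \<open>x t \<ge> 0\<close>, then
  \<open>X t \<ge> X 0\<close>.\<close>

lemma second_order_comparison:
  fixes X x y :: "real \<Rightarrow> real"
  assumes \<alpha>: "\<alpha> > 0"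
    and X: "\<And>t. 0 \<le> t \<Longrightarrow> t < 1 \<Longrightarrow> (X has_real_derivative x t) (at t)"
    and x: "\<And>t. 0 \<le> t \<Longrightarrow> t < 1 \<Longrightarrow> (x has_real_derivative y t) (at t)"
    and ge: "\<And>t. 0 < t \<Longrightarrow> t < 1 \<Longrightarrow> x t + \<alpha> * t * y t \<ge> 0"
    and X0: "X 0 \<ge> 0" and t: "0 \<le> t" "t < 1"
  shows "X t \<ge> 0"
proof -
  have x_nonneg: "x s \<ge> 0" if s: "0 < s" "s < 1" for s
  proof -
    \<comment> \<open>Since \<open>0 powr (1/\<alpha>) = 0\<close>, this says that the right side is
      nonnegative.\<close>
    have "0 powr (1/\<alpha>) * x 0 \<le> s powr (1/\<alpha>) * x s"
    proof (rule DERIV_nonneg_imp_increasing_open[where f = "\<lambda>s. s powr (1/\<alpha>) * x s"])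
      fix u assume u: "0 < u" "u < s"
      have "((\<lambda>s. s powr (1/\<alpha>) * x s) has_real_derivative
          (1/\<alpha>) * u powr (1/\<alpha> - 1) * x u + y u * u powr (1/\<alpha>)) (at u)"
        using u s by (intro DERIV_mult has_real_derivative_powr x) auto
      also have "(1/\<alpha>) * u powr (1/\<alpha> - 1) * x u + y u * u powr (1/\<alpha>)
          = (u powr (1/\<alpha> - 1) / \<alpha>) * (x u + \<alpha> * u * y u)"
      proof -
        have "u powr (1/\<alpha>) = u * u powr (1/\<alpha> - 1)"
          using u by (simp add: powr_mult_base)
        then show ?thesis using \<alpha> by (simp add: distrib_left)
      qed
      finally show "\<exists>d. ((\<lambda>s. s powr (1/\<alpha>) * x s) has_real_derivative d) (at u) \<and> d \<ge> 0"
        using ge[of u] u s \<alpha>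
        by (auto intro!: exI[of _ "u powr (1 / \<alpha> - 1) / \<alpha> * (x u + \<alpha> * u * y u)"])
    next
      have "continuous_on {0..s} x"
        using s by (intro continuous_at_imp_continuous_on ballI, intro DERIV_isCont[OF x]) auto
      \<comment> \<open>The weight may fail to be differentiable at 0, but its exponent is positive,
        so it is continuous there; derivatives are needed only in the open interval.\<close>
      then show "continuous_on {0..s} (\<lambda>s. s powr (1/\<alpha>) * x s)"
        using \<alpha> by (intro continuous_on_mult continuous_on_powr' continuous_on_id continuous_on_const) auto
    qed (use s in auto)
    then show ?thesis using s by (simp add: zero_le_mult_iff)
  qed
  have "X 0 \<le> X t"
  proof (rule DERIV_nonneg_imp_increasing_open[where f = X])
    show "\<exists>d. (X has_real_derivative d) (at u) \<and> d \<ge> 0" if "0 < u" "u < t" for u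
      using X[of u] x_nonneg[of u] that t by auto
    show "continuous_on {0..t} X"
      using t by (intro continuous_at_imp_continuous_on ballI, intro DERIV_isCont[OF X]) auto
  qed (use t in auto)
  then show ?thesis using X0 by simp
qed

text \<open>The free constant \<open>c\<close> lets the lemma be iterated: the second derivative
  along the ray comes from \<open>deriv F\<close> with the constant \<open>c * u\<close>.\<close>

lemma has_real_derivative_Re_ray:
  assumes "F holomorphic_on ball 0 1" "cmod u = 1" "\<bar>t\<bar> < 1"
  shows "((\<lambda>t. Re (c * F (u * of_real t))) has_real_derivative
    Re (c * u * deriv F (u * of_real t))) (at t)"
proof -
  have F: "(F has_field_derivative deriv F (u * of_real t)) (at (u * of_real t))"
    using assms by (intro holomorphic_derivI[of _ "ball 0 1"]) (auto simp: norm_mult)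
  have "((\<lambda>t::real. u * of_real t) has_vector_derivative u) (at t)"
    by (auto intro!: derivative_eq_intros)
  from field_vector_diff_chain_at[OF this F]
  have "((\<lambda>t. c * F (u * of_real t)) has_vector_derivative c * (u * deriv F (u * of_real t))) (at t)"
    by (intro has_vector_derivative_mult_right) (simp add: o_def)
  then have "((\<lambda>t. Re (c * F (u * of_real t))) has_vector_derivative
      Re (c * (u * deriv F (u * of_real t)))) (at t)"
    by (rule bounded_linear.has_vector_derivative[OF bounded_linear_Re])
  then show ?thesis by (simp add: has_real_derivative_iff_has_vector_derivative mult.assoc)
qed

text \<open>The operator in the condition defining \<open>class_W0\<close>. It sends z^n to n (1 +
  \<alpha> (n - 1)) z^(n-1), and this factor is the denominator \<alpha> n^2 + n (1 - \<alpha>) of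
  the growth series.\<close>

definition W_operator :: "real \<Rightarrow> (complex \<Rightarrow> complex) \<Rightarrow> complex \<Rightarrow> complex"
  where "W_operator \<alpha> F z = deriv F z + of_real \<alpha> * z * deriv (deriv F) z"

text \<open>For the difference \<open>X\<close> of the two real parts, X' + \<alpha> t X'' is the
  right side of \<open>le\<close> minus the left side. Separate directions \<open>u\<close>,
  \<open>v\<close> and multipliers \<open>c\<close>, \<open>d\<close> allow \<open>F\<close> on any
  ray to be compared with the extremal function on the positive or negative real axis.\<close>

lemma Re_ray_comparison:
  fixes \<alpha> :: real and c d u v :: complex and F G :: "complex \<Rightarrow> complex"
  assumes \<alpha>: "\<alpha> > 0"
    and F: "F holomorphic_on ball 0 1" "F 0 = 0" "cmod u = 1"
    and G: "G holomorphic_on ball 0 1" "G 0 = 0" "cmod v = 1"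
    and le: "\<And>t. 0 < t \<Longrightarrow> t < 1 \<Longrightarrow>
        Re (c * u * W_operator \<alpha> F (u * of_real t))
      \<le> Re (d * v * W_operator \<alpha> G (v * of_real t))"
    and t: "0 \<le> t" "t < 1"
  shows "Re (c * F (u * of_real t)) \<le> Re (d * G (v * of_real t))"
proof -
  have F': "deriv F holomorphic_on ball 0 1" and G': "deriv G holomorphic_on ball 0 1"
    using F G by (auto intro: holomorphic_deriv)
  define X where "X t = Re (d * G (v * of_real t)) - Re (c * F (u * of_real t))" for t
  define x where "x t = Re (d * v * deriv G (v * of_real t)) - Re (c * u * deriv F (u * of_real t))" for t
  define y where "y t = Re (d * v * v * deriv (deriv G) (v * of_real t))
    - Re (c * u * u * deriv (deriv F) (u * of_real t))" for t
  have "X t \<ge> 0"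
  proof (rule second_order_comparison[where X = X and x = x and y = y, OF \<alpha>])
    show "(X has_real_derivative x t) (at t)" if "0 \<le> t" "t < 1" for t
      unfolding X_def x_def using that F G
      by (intro DERIV_diff has_real_derivative_Re_ray) auto
    show "(x has_real_derivative y t) (at t)" if "0 \<le> t" "t < 1" for t
      unfolding x_def y_def using that F' G' F(3) G(3)
      by (intro DERIV_diff has_real_derivative_Re_ray) auto
    show "x t + \<alpha> * t * y t \<ge> 0" if "0 < t" "t < 1" for t
    proof -
      \<comment> \<open>The \<open>w\<close> in \<open>w * of_real t\<close> supplies the second
        factor \<open>w\<close> that the second derivative along the ray carries.\<close>
      have "Re (e * w * (p + of_real \<alpha> * (w * of_real t) * q))
          = Re (e * w * p) + \<alpha> * t * Re (e * w * w * q)" for e w p q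
      proof -
        have "e * w * (p + of_real \<alpha> * (w * of_real t) * q)
          = e * w * p + of_real (\<alpha> * t) * (e * w * w * q)" by (simp add: algebra_simps)
        then show ?thesis by (simp only: plus_complex.sel scaleR_conv_of_real[symmetric] scaleR_complex.sel)
      qed
      then show ?thesis using le[OF that] by (simp add: W_operator_def x_def y_def algebra_simps)
    qed
    show "X 0 \<ge> 0" using F G by (simp add: X_def)
  qed (use t in auto)
  then show ?thesis by (simp add: X_def)
qed

section \<open>The extremal function and its power series\<close>

text \<open>At \<open>n = 0\<close> the denominator vanishes, so the coefficient is \<open>0\<close>, as it should be.\<close>

definition extremal_coeff :: "real \<Rightarrow> nat \<Rightarrow> real"
  where "extremal_coeff \<alpha> n =
    (if n = 1 then 1 else 2 / (\<alpha> * (real n)\<^sup>2 + real n * (1 - \<alpha>)))"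

text \<open>The denominator at n + 1 factors as (n + 1) (1 + \<alpha> n), the multiplier in
  \<open>W_operator\<close>. The resulting values 1, 2, 2, ... are the Taylor coefficients of (1 +
  z) / (1 - z).\<close>

lemma extremal_coeff_Suc:
  assumes "\<alpha> > 0"
  shows "real (Suc n) * (1 + \<alpha> * real n) * extremal_coeff \<alpha> (Suc n) = (if n = 0 then 1 else 2)"
proof -
  have "\<alpha> * (real (Suc n))\<^sup>2 + real (Suc n) * (1 - \<alpha>) = real (Suc n) * (1 + \<alpha> * real n)"
    by (simp add: power2_eq_square algebra_simps)
  moreover have "real (Suc n) * (1 + \<alpha> * real n) \<noteq> 0"
    using assms by (simp add: add_nonneg_eq_0_iff)
  ultimately show ?thesis by (auto simp: extremal_coeff_def)
qed

lemma extremal_coeff_bounds: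
  assumes "\<alpha> > 0"
  shows "0 \<le> extremal_coeff \<alpha> n" "extremal_coeff \<alpha> n \<le> 2"
proof -
  have "0 \<le> extremal_coeff \<alpha> n \<and> extremal_coeff \<alpha> n \<le> 2"
  proof (cases n)
    case (Suc m)
    have "1 * 1 \<le> real (Suc m) * (1 + \<alpha> * real m)"
      using assms by (intro mult_mono) auto
    moreover have "extremal_coeff \<alpha> n = (if m = 0 then 1 else 2) / (real (Suc m) * (1 + \<alpha> * real m))"
      using extremal_coeff_Suc[OF assms, of m] calculation Suc by (simp add: field_simps)
    ultimately show ?thesis by (auto simp: divide_le_eq)
  qed (simp add: extremal_coeff_def)
  then show "0 \<le> extremal_coeff \<alpha> n" "extremal_coeff \<alpha> n \<le> 2" by auto
qed

text \<open>The field is left general because the series is used at real arguments for the growth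
  functions and at complex ones for \<open>extremal\<close>.\<close>

lemma summable_extremal_coeff:
  fixes z :: "'a :: {real_normed_field, banach}"
  assumes "\<alpha> > 0" "norm z < 1"
  shows "summable (\<lambda>n. norm (of_real (extremal_coeff \<alpha> n) * z ^ n))"
proof (rule summable_comparison_test')
  show "summable (\<lambda>n. 2 * norm z ^ n)"
    using assms by (intro summable_mult summable_geometric) auto
  show "norm (norm (of_real (extremal_coeff \<alpha> n) * z ^ n)) \<le> 2 * norm z ^ n" if "n \<ge> 0" for n
    using extremal_coeff_bounds[OF assms(1), of n]
    by (auto simp: norm_mult norm_power intro!: mult_right_mono)
qed

text \<open>Absolute convergence turns the unordered sum into a power series, whose term at 1 is the
  separate \<open>z\<close> and whose term at 0 vanishes.\<close>

lemma infsum_extremal_coeff: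
  fixes z :: "'a :: {real_normed_field, banach}"
  assumes "\<alpha> > 0" "norm z < 1"
  shows "z + (\<Sum>\<^sub>\<infinity>n\<in>{2..}. of_real (2 / (\<alpha> * (real n)\<^sup>2 + real n * (1 - \<alpha>))) * z ^ n)
    = (\<Sum>n. of_real (extremal_coeff \<alpha> n) * z ^ n)"
proof -
  let ?f = "\<lambda>n. of_real (extremal_coeff \<alpha> n) * z ^ n"
  note s = summable_extremal_coeff[OF assms]
  have "((\<lambda>n. ?f n) has_sum suminf ?f) UNIV"
    using s by (intro norm_summable_imp_has_sum summable_sums) (auto intro: summable_norm_cancel)
  then have h: "(?f has_sum (suminf ?f - z)) (UNIV - {0, 1})"
    using has_sum_Diff[of ?f UNIV _ "{0, 1}" "\<Sum>n\<in>{0,1}. ?f n"]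
    by (simp add: extremal_coeff_def has_sum_finite_iff)
  have "UNIV - {0, 1} = {2::nat..}" by auto
  with h have "(?f has_sum (suminf ?f - z)) {2..}" by simp
  then have "infsum ?f {2..} = suminf ?f - z" by (rule infsumI)
  moreover have "infsum ?f {2..} = (\<Sum>\<^sub>\<infinity>n\<in>{2..}. of_real (2 / (\<alpha> * (real n)\<^sup>2 + real n * (1 - \<alpha>))) * z ^ n)"
    by (intro infsum_cong) (auto simp: extremal_coeff_def)
  ultimately show ?thesis by simp
qed

lemma extremal_eq_suminf:
  assumes "\<alpha> > 0" "cmod z < 1"
  shows "extremal \<alpha> z = (\<Sum>n. of_real (extremal_coeff \<alpha> n) * z ^ n)"
  unfolding extremal_def using assms by (rule infsum_extremal_coeff)

lemma extremal_of_real: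
  assumes "\<alpha> > 0" "\<bar>t\<bar> < 1"
  shows "extremal \<alpha> (of_real t) = of_real (\<Sum>n. extremal_coeff \<alpha> n * t ^ n)"
proof -
  have "summable (\<lambda>n. extremal_coeff \<alpha> n * t ^ n)"
    using summable_norm_cancel[OF summable_extremal_coeff[of \<alpha> t]] assms by simp
  then show ?thesis using assms by (simp add: extremal_eq_suminf suminf_of_real)
qed

lemma growth_upper_eq:
  assumes "\<alpha> > 0" "\<bar>t\<bar> < 1"
  shows "of_real (growth_upper \<alpha> t) = extremal \<alpha> (of_real t)"
proof -
  have "growth_upper \<alpha> t = t + (\<Sum>\<^sub>\<infinity>n\<in>{2..}. 2 / (\<alpha> * (real n)\<^sup>2 + real n * (1 - \<alpha>)) * t ^ n)"
    unfolding growth_upper_def by (subst infsum_cmult_right'[symmetric]) (simp add: field_simps)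
  also have "\<dots> = (\<Sum>n. extremal_coeff \<alpha> n * t ^ n)"
    using infsum_extremal_coeff[of \<alpha> t] assms by simp
  finally show ?thesis using extremal_of_real assms by simp
qed

text \<open>The signs are absorbed into the argument: (-1)^(n-1) t^n = -(-t)^n.\<close>

lemma growth_lower_eq:
  assumes "\<alpha> > 0" "\<bar>t\<bar> < 1"
  shows "of_real (growth_lower \<alpha> t) = - extremal \<alpha> (- of_real t)"
proof -
  have *: "2 * ((-1) ^ (n - 1) * t ^ n / (\<alpha> * (real n)\<^sup>2 + real n * (1 - \<alpha>)))
      = - (2 / (\<alpha> * (real n)\<^sup>2 + real n * (1 - \<alpha>)) * (- t) ^ n)" if "n \<in> {2..}" for n
    using that by (cases n) (auto simp: power_minus[of t])
  have "growth_lower \<alpha> t = - (- t + (\<Sum>\<^sub>\<infinity>n\<in>{2..}. 2 / (\<alpha> * (real n)\<^sup>2 + real n * (1 - \<alpha>)) * (- t) ^ n))"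
    unfolding growth_lower_def
    by (subst infsum_cmult_right'[symmetric], subst infsum_cong[OF *], assumption)
      (simp add: infsum_uminus)
  also have "\<dots> = - (\<Sum>n. extremal_coeff \<alpha> n * (- t) ^ n)"
    using infsum_extremal_coeff[of \<alpha> "- t"] assms by simp
  finally show ?thesis using extremal_of_real[of \<alpha> "- t"] assms by simp
qed

text \<open>The series is differentiated termwise, with \<open>diffs\<close> giving the coefficients
  of the derivative. Applying \<open>W_operator\<close> leaves the coefficients 1, 2, 2, ..., whose
  sum is 2 / (1 - z) - 1.\<close>

lemma extremal_properties:
  assumes \<alpha>: "\<alpha> > 0"
  shows "extremal \<alpha> holomorphic_on ball 0 1" "extremal \<alpha> 0 = 0" "deriv (extremal \<alpha>) 0 = 1"
    "\<And>z. cmod z < 1 \<Longrightarrow>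
      W_operator \<alpha> (extremal \<alpha>) z = (1 + z) / (1 - z)"
proof -
  define a where "a n = complex_of_real (extremal_coeff \<alpha> n)" for n
  have sa: "summable (\<lambda>n. a n * z ^ n)" if "cmod z < 1" for z
    unfolding a_def using summable_norm_cancel[OF summable_extremal_coeff[OF \<alpha> that]] .
  have sd: "summable (\<lambda>n. diffs a n * z ^ n)" if "cmod z < 1" for z
    using termdiff_converges[OF that sa] .
  have sdd: "summable (\<lambda>n. diffs (diffs a) n * z ^ n)" if "cmod z < 1" for z
    using termdiff_converges[OF that sd] .
  have D1: "(extremal \<alpha> has_field_derivative (\<Sum>n. diffs a n * z ^ n)) (at z)" if "cmod z < 1" for z
  proof (rule has_field_derivative_transform_within_open)
    show "((\<lambda>z. \<Sum>n. a n * z ^ n) has_field_derivative (\<Sum>n. diffs a n * z ^ n)) (at z)"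
      using termdiffs_strong'[OF sa that] .
  qed (use that extremal_eq_suminf[OF \<alpha>] in \<open>auto simp: a_def intro: open_ball[of 0 1]\<close>)
  have d1: "deriv (extremal \<alpha>) z = (\<Sum>n. diffs a n * z ^ n)" if "cmod z < 1" for z
    using D1[OF that] by (rule DERIV_imp_deriv)
  have D2: "(deriv (extremal \<alpha>) has_field_derivative (\<Sum>n. diffs (diffs a) n * z ^ n)) (at z)"
    if "cmod z < 1" for z
  proof (rule has_field_derivative_transform_within_open)
    show "((\<lambda>z. \<Sum>n. diffs a n * z ^ n) has_field_derivative (\<Sum>n. diffs (diffs a) n * z ^ n)) (at z)"
      using termdiffs_strong'[OF sd that] .
  qed (use that d1 in \<open>auto intro: open_ball[of 0 1]\<close>)
  show "extremal \<alpha> holomorphic_on ball 0 1"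
    unfolding holomorphic_on_open[OF open_ball] by (intro ballI exI, rule D1) simp
  show "extremal \<alpha> 0 = 0"
    using extremal_eq_suminf[OF \<alpha>, of 0] by (simp add: extremal_coeff_def)
  show "deriv (extremal \<alpha>) 0 = 1"
    using d1[of 0] by (simp add: diffs_def a_def extremal_coeff_def)
  fix z :: complex assume z: "cmod z < 1"
  have "(\<lambda>n. diffs a n * z ^ n) sums deriv (extremal \<alpha>) z"
    using sd[OF z] d1[OF z] by (simp add: summable_sums)
  moreover have "(\<lambda>n. of_nat n * diffs a n * z ^ n) sums (z * deriv (deriv (extremal \<alpha>)) z)"
  proof -
    have "(\<lambda>n. z * (diffs (diffs a) n * z ^ n)) sums (z * deriv (deriv (extremal \<alpha>)) z)"
      using sdd[OF z] DERIV_imp_deriv[OF D2[OF z]] by (intro sums_mult) (simp add: summable_sums)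
    then have "(\<lambda>n. of_nat (Suc n) * diffs a (Suc n) * z ^ Suc n) sums (z * deriv (deriv (extremal \<alpha>)) z)"
      by (simp add: diffs_def[of "diffs a"] mult_ac)
    \<comment> \<open>The index shift adds a term at 0, which vanishes because of its factor
      n.\<close>
    from sums_Suc[OF this] show ?thesis by simp
  qed
  ultimately have "(\<lambda>n. diffs a n * z ^ n + \<alpha> * (of_nat n * diffs a n * z ^ n)) sums
      (deriv (extremal \<alpha>) z + \<alpha> * (z * deriv (deriv (extremal \<alpha>)) z))"
    by (intro sums_add sums_mult)
  moreover have "diffs a n * z ^ n + \<alpha> * (of_nat n * diffs a n * z ^ n)
      = 2 * z ^ n - (if n = 0 then 1 else 0)" for n
  proof -
    have "diffs a n * z ^ n + \<alpha> * (of_nat n * diffs a n * z ^ n)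
      = of_real (real (Suc n) * (1 + \<alpha> * real n) * extremal_coeff \<alpha> (Suc n)) * z ^ n"
      by (simp add: diffs_def a_def algebra_simps)
    then show ?thesis unfolding extremal_coeff_Suc[OF \<alpha>] by auto
  qed
  moreover have "(\<lambda>n. 2 * z ^ n - (if n = 0 then 1 else 0)) sums (2 * (1 / (1 - z)) - 1)"
    using z by (intro sums_diff sums_mult geometric_sums) (use sums_single[of 0 "\<lambda>_. 1::complex"] in auto)
  ultimately have "deriv (extremal \<alpha>) z + \<alpha> * (z * deriv (deriv (extremal \<alpha>)) z) = 2 * (1 / (1 - z)) - 1"
    by (simp add: sums_unique2)
  also have "\<dots> = (1 + z) / (1 - z)"
  proof -
    have "1 - z \<noteq> 0" using z by auto
    then show ?thesis by (simp add: field_simps)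
  qed
  finally show "W_operator \<alpha> (extremal \<alpha>) z = (1 + z) / (1 - z)"
    by (simp add: W_operator_def mult_ac)
qed

text \<open>The real part is (1 - |z|^2) / |1 - z|^2.\<close>

lemma Re_cayley_pos:
  assumes "cmod z < 1"
  shows "Re ((1 + z) / (1 - z)) > 0"
proof -
  have "1 - z \<noteq> 0" using assms by auto
  moreover have "(Re z)\<^sup>2 + (Im z)\<^sup>2 < 1"
    using assms abs_square_less_1[of "cmod z"] by (simp add: cmod_power2)
  then have "Re (1 + z) * Re (1 - z) + Im (1 + z) * Im (1 - z) > 0"
    by (simp add: power2_eq_square algebra_simps)
  ultimately show ?thesis
    unfolding Re_divide cmod_power2[symmetric] by (intro divide_pos_pos) auto
qed

section \<open>Growth bounds for the class\<close>

lemma ex_unit_mult_eq_cmod: "\<exists>v. cmod v = 1 \<and> v * w = of_real (cmod w)"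
proof (cases "w = 0")
  case False
  have "cnj w * w = of_real (cmod w) * of_real (cmod w)"
    using complex_norm_square[of w] by (simp add: power2_eq_square mult.commute)
  with False have "cmod (cnj w / of_real (cmod w)) = 1 \<and> cnj w / of_real (cmod w) * w = of_real (cmod w)"
    by (simp add: norm_divide)
  then show ?thesis by blast
qed (auto intro: exI[of _ 1])

lemma W0_growth:
  assumes \<alpha>: "\<alpha> > 0" and f: "f \<in> class_W0 \<alpha>" and z: "cmod z < 1"
  shows "growth_lower \<alpha> (cmod z) \<le> cmod (f z)" "cmod (f z) \<le> growth_upper \<alpha> (cmod z)"
proof -
  obtain h g where hol: "h holomorphic_on ball 0 1" "g holomorphic_on ball 0 1"
    and h0: "h 0 = 0" "deriv h 0 = 1" and g0: "g 0 = 0" "deriv g 0 = 0"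
    and fz: "f z = h z + cnj (g z)"
    and W: "\<And>w. cmod w < 1 \<Longrightarrow> Re (deriv h w + of_real \<alpha> * w * deriv (deriv h) w)
                    > cmod (deriv g w + of_real \<alpha> * w * deriv (deriv g) w)"
    using f z by (auto simp: class_W0_def canonical_rep_def)
  note E = extremal_properties[OF \<alpha>]
  define r where "r = cmod z"
  have r: "0 \<le> r" "r < 1" using z by (auto simp: r_def)
  obtain u where u: "cmod u = 1" and zu: "z = u * of_real r"
  proof (cases "z = 0")
    case True
    then show thesis using that[of 1] by (simp add: r_def)
  next
    case False
    then show thesis using that[of "z / of_real r"] by (simp add: r_def norm_divide)
  qed
  have cu: "cnj u * u = 1"
    using complex_norm_square[of u] u by (simp add: mult.commute)
  \<comment> \<open>In the lower bound the multiplier \<open>cnj u\<close> cancels the direction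
    \<open>u\<close> that differentiation along the ray brings in, leaving Re P. The upper bound
    uses only |P|, so any unimodular \<open>v\<close> will do.\<close>
  have bounds: "growth_lower \<alpha> r \<le> Re (cnj u * (h z + \<epsilon> * g z))"
    "cmod v = 1 \<Longrightarrow> Re (v * (h z + \<epsilon> * g z)) \<le> growth_upper \<alpha> r" if \<epsilon>: "cmod \<epsilon> = 1" for \<epsilon> v
  proof -
    define F where "F = (\<lambda>w. h w + \<epsilon> * g w)"
    define P where "P = W_operator \<alpha> F"
    have F: "F holomorphic_on ball 0 1" unfolding F_def
      by (intro holomorphic_intros hol)
    have hol': "deriv h holomorphic_on ball 0 1" "deriv g holomorphic_on ball 0 1"
      using hol by (auto intro: holomorphic_deriv)
    have d: "deriv (\<lambda>w. a w + \<epsilon> * b w) w = deriv a w + \<epsilon> * deriv b w"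
      if "a holomorphic_on ball 0 1" "b holomorphic_on ball 0 1" "cmod w < 1" for a b w
      using that
      by (intro DERIV_imp_deriv DERIV_add DERIV_cmult holomorphic_derivI[of _ "ball 0 1"]) auto
    have F': "deriv F w = deriv h w + \<epsilon> * deriv g w" if "cmod w < 1" for w
      using d[OF hol that] by (simp add: F_def)
    have F'': "deriv (deriv F) w = deriv (deriv h) w + \<epsilon> * deriv (deriv g) w" if "cmod w < 1" for w
    proof -
      have "deriv (deriv F) w = deriv (\<lambda>w. deriv h w + \<epsilon> * deriv g w) w"
        using F' eventually_nhds_in_open[of "ball 0 1" w] that
        by (intro deriv_cong_ev) (auto elim: eventually_mono)
      then show ?thesis using d[OF hol' that] by simp
    qed
    have P: "P holomorphic_on ball 0 1" unfolding P_def W_operator_def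
      by (intro holomorphic_intros F) auto
    \<comment> \<open>As \<epsilon> is unimodular, Re P >= Re ?p - |?q|, which is positive by the
      class condition.\<close>
    have Ppos: "Re (P w) > 0" if "cmod w < 1" for w
    proof -
      let ?p = "deriv h w + of_real \<alpha> * w * deriv (deriv h) w"
      let ?q = "deriv g w + of_real \<alpha> * w * deriv (deriv g) w"
      have "P w = ?p + \<epsilon> * ?q"
        using F'[OF that] F''[OF that] by (simp add: P_def W_operator_def algebra_simps)
      moreover have "\<bar>Re (\<epsilon> * ?q)\<bar> \<le> cmod ?q"
        using abs_Re_le_cmod[of "\<epsilon> * ?q"] \<epsilon> by (simp add: norm_mult)
      ultimately show ?thesis using W[OF that] by simp
    qed
    have P0: "P 0 = 1" using F'[of 0] h0 g0 by (simp add: P_def W_operator_def)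
    have ray: "cmod (u * of_real t) = t" if "0 \<le> t" for t
      using u that by (simp add: norm_mult)
    have F0: "F 0 = 0" using h0 g0 by (simp add: F_def)
    \<comment> \<open>The comparison function is -E(-t) with E the extremal function: there the
      operator gives exactly (1 - t) / (1 + t), the lower bound for Re P.\<close>
    have "Re ((-1) * extremal \<alpha> (-1 * of_real r)) \<le> Re (cnj u * F (u * of_real r))"
    proof (rule Re_ray_comparison[OF \<alpha> E(1,2) _ F F0 u _ r])
      fix t :: real assume t: "0 < t" "t < 1"
      have "W_operator \<alpha> (extremal \<alpha>) (-1 * of_real t)
          = of_real ((1 - t) / (1 + t))"
        using E(4)[of "-1 * of_real t"] t by simp
      moreover have "(1 - t) / (1 + t) \<le> Re (P (u * of_real t))"
        using Caratheodory_bounds(1)[OF P Ppos P0, of "u * of_real t"] t ray[of t] by simp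
      ultimately show "Re (-1 * -1 * W_operator \<alpha> (extremal \<alpha>) (-1 * of_real t))
        \<le> Re (cnj u * u * W_operator \<alpha> F (u * of_real t))"
        unfolding P_def cu by simp
    qed simp
    moreover have "Re (-1 * extremal \<alpha> (-1 * of_real r)) = growth_lower \<alpha> r"
      using growth_lower_eq[OF \<alpha>, of r] r by (metis Re_complex_of_real abs_of_nonneg mult_minus1)
    ultimately show "growth_lower \<alpha> r \<le> Re (cnj u * (h z + \<epsilon> * g z))"
      by (simp add: F_def zu)
    assume v: "cmod v = 1"
    have "Re (v * F (u * of_real r)) \<le> Re (1 * extremal \<alpha> (1 * of_real r))"
    proof (rule Re_ray_comparison[OF \<alpha> F F0 u E(1,2) _ _ r])
      fix t :: real assume t: "0 < t" "t < 1"
      have "W_operator \<alpha> (extremal \<alpha>) (1 * of_real t)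
          = of_real ((1 + t) / (1 - t))"
        using E(4)[of "of_real t"] t by simp
      moreover have "Re (v * u * P (u * of_real t)) \<le> (1 + t) / (1 - t)"
        using Caratheodory_bounds(2)[OF P Ppos P0, of "u * of_real t"] t ray[of t]
          complex_Re_le_cmod[of "v * u * P (u * of_real t)"] u v by (simp add: norm_mult)
      ultimately show "Re (v * u * W_operator \<alpha> F (u * of_real t))
        \<le> Re (1 * 1 * W_operator \<alpha> (extremal \<alpha>) (1 * of_real t))"
        unfolding P_def by simp
    qed simp
    moreover have "Re (1 * extremal \<alpha> (1 * of_real r)) = growth_upper \<alpha> r"
      using growth_upper_eq[OF \<alpha>, of r] r by (metis Re_complex_of_real abs_of_nonneg mult_1)
    ultimately show "Re (v * (h z + \<epsilon> * g z)) \<le> growth_upper \<alpha> r"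
      by (simp add: F_def zu)
  qed
  \<comment> \<open>Taking \<epsilon> = -w makes the contribution of g(z) equal to -|g(z)|.\<close>
  obtain w where w: "cmod w = 1" "w * (cnj u * g z) = of_real (cmod (cnj u * g z))"
    using ex_unit_mult_eq_cmod by blast
  have "cnj u * (h z + (- w) * g z) = cnj u * h z - of_real (cmod (g z))"
    using w(2) u by (simp add: norm_mult algebra_simps)
  then have "growth_lower \<alpha> r \<le> Re (cnj u * h z) - cmod (g z)"
    using bounds(1)[of "- w"] w(1) by simp
  also have "\<dots> \<le> cmod (h z) - cmod (g z)"
    using complex_Re_le_cmod[of "cnj u * h z"] u by (simp add: norm_mult)
  also have "\<dots> \<le> cmod (f z)"
    using norm_diff_ineq[of "h z" "cnj (g z)"] by (simp add: fz)
  finally show "growth_lower \<alpha> (cmod z) \<le> cmod (f z)" by (simp add: r_def)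
  \<comment> \<open>First \<open>v\<close> turns h(z) into its modulus, then \<epsilon> = w aligns v
    g(z) with it, so that the moduli add.\<close>
  obtain v where v: "cmod v = 1" "v * h z = of_real (cmod (h z))"
    using ex_unit_mult_eq_cmod by blast
  obtain w where w: "cmod w = 1" "w * (v * g z) = of_real (cmod (v * g z))"
    using ex_unit_mult_eq_cmod by blast
  have "v * (h z + w * g z) = of_real (cmod (h z) + cmod (g z))"
    using w(2) v by (simp add: norm_mult algebra_simps)
  then have "cmod (h z) + cmod (g z) \<le> growth_upper \<alpha> r"
    using bounds(2)[OF w(1) v(1)] by simp
  then show "cmod (f z) \<le> growth_upper \<alpha> (cmod z)"
    using norm_triangle_ineq[of "h z" "cnj (g z)"] by (simp add: fz r_def)
qed

section \<open>Sharpness for the extremal function and its rotations\<close>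

text \<open>Needed because attainment at -r directly yields only the absolute value of
  \<open>growth_lower\<close>. The multiplier 0 on the left makes the ray comparison one with the
  zero function.\<close>

lemma growth_lower_nonneg:
  assumes \<alpha>: "\<alpha> > 0" and r: "0 \<le> r" "r < 1"
  shows "growth_lower \<alpha> r \<ge> 0"
proof -
  note E = extremal_properties[OF \<alpha>]
  have "Re (0 * extremal \<alpha> (1 * of_real r)) \<le> Re ((-1) * extremal \<alpha> (-1 * of_real r))"
  proof (rule Re_ray_comparison[OF \<alpha> E(1,2) _ E(1,2) _ _ r])
    fix t :: real assume t: "0 < t" "t < 1"
    show "Re (0 * 1 * W_operator \<alpha> (extremal \<alpha>) (1 * of_real t))
      \<le> Re (-1 * -1 * W_operator \<alpha> (extremal \<alpha>) (-1 * of_real t))"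
      using E(4)[of "-1 * of_real t"] Re_cayley_pos[of "-1 * of_real t"] t by simp
  qed auto
  then show ?thesis
    using growth_lower_eq[OF \<alpha>, of r] r
    by (metis Re_complex_of_real abs_of_nonneg mult_minus1 mult_zero_left zero_complex.sel(1))
qed

text \<open>The analytic part is the rotation itself and the co-analytic part is 0, so only Re > 0
  remains. With c = e^(i \<theta>), the operator applied to the rotation at z equals the operator
  applied to the extremal function at cz.\<close>

lemma rotation_extremal_in_W0:
  assumes \<alpha>: "\<alpha> > 0"
  shows "rotation \<theta> (extremal \<alpha>) \<in> class_W0 \<alpha>"
proof -
  note E = extremal_properties[OF \<alpha>]
  define c where "c = exp (\<i> * of_real \<theta>)"
  have c: "cmod c = 1" "exp (- \<i> * of_real \<theta>) * c = 1"
    by (simp_all add: c_def exp_minus)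
  have R: "rotation \<theta> (extremal \<alpha>) = (\<lambda>z. exp (- \<i> * of_real \<theta>) * extremal \<alpha> (c * z))" (is "?R = _")
    by (simp add: rotation_def c_def fun_eq_iff)
  have disc: "cmod (c * z) < 1" if "cmod z < 1" for z
    using that c by (simp add: norm_mult)
  have chain: "((\<lambda>z. G (c * z)) has_field_derivative deriv G (c * z) * c) (at z)"
    if "G holomorphic_on ball 0 1" "cmod z < 1" for G z
    using that disc[of z]
    by (intro DERIV_chain2[of G] holomorphic_derivI[of G "ball 0 1"])
      (auto intro!: derivative_eq_intros)
  have D1: "(?R has_field_derivative deriv (extremal \<alpha>) (c * z)) (at z)" if "cmod z < 1" for z
  proof -
    have "exp (- \<i> * of_real \<theta>) * (deriv (extremal \<alpha>) (c * z) * c) = deriv (extremal \<alpha>) (c * z)"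
      using c(2) by (metis mult.commute mult.left_commute mult_1)
    then show ?thesis
      using DERIV_cmult[OF chain[OF E(1) that], of "exp (- \<i> * of_real \<theta>)"]
      unfolding R by metis
  qed
  have d1: "deriv ?R z = deriv (extremal \<alpha>) (c * z)" if "cmod z < 1" for z
    using D1[OF that] by (rule DERIV_imp_deriv)
  have d2: "deriv (deriv ?R) z = c * deriv (deriv (extremal \<alpha>)) (c * z)" if "cmod z < 1" for z
  proof -
    have "deriv (deriv ?R) z = deriv (\<lambda>z. deriv (extremal \<alpha>) (c * z)) z"
      using d1 eventually_nhds_in_open[of "ball 0 1" z] that
      by (intro deriv_cong_ev) (auto elim: eventually_mono)
    then show ?thesis
      using DERIV_imp_deriv[OF chain[OF holomorphic_deriv[OF E(1) open_ball] that]]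
      by (simp add: mult.commute)
  qed
  have hol: "?R holomorphic_on ball 0 1"
    unfolding holomorphic_on_open[OF open_ball] by (intro ballI exI, rule D1) simp
  have R0: "?R 0 = 0" "deriv ?R 0 = 1" using E(2,3) d1[of 0] by (simp_all add: R)
  have "wirtinger_z ?R 0 = 1"
    using holomorphic_pdx_pdy[OF open_ball hol, of ?R 0] R0 by (simp add: wirtinger_z_def)
  then have H: "?R \<in> class_H"
    using holomorphic_imp_complex_harmonic_on[OF open_ball hol] R0 by (simp add: class_H_def)
  have rep: "canonical_rep ?R ?R (\<lambda>_. 0)"
    using hol R0 by (simp add: canonical_rep_def)
  have "Re (deriv ?R z + of_real \<alpha> * z * deriv (deriv ?R) z) > 0" if "cmod z < 1" for z
    using Re_cayley_pos[OF disc[OF that]] E(4)[OF disc[OF that], symmetric] d1[OF that] d2[OF that]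
    by (simp add: W_operator_def mult_ac)
  then show ?thesis
    using H rep unfolding class_W0_def
    by (intro CollectI conjI exI[of _ ?R] exI[of _ "\<lambda>_. 0"]) simp_all
qed

text \<open>This transfers the points -r and r, where the extremal function attains the bounds, to
  every rotation.\<close>

lemma rotation_at_back_rotated:
  "cmod (rotation \<theta> f (exp (- \<i> * of_real \<theta>) * w)) = cmod (f w)"
proof -
  have "exp (\<i> * of_real \<theta>) * exp (- \<i> * of_real \<theta>) = 1"
    by (simp add: exp_minus)
  then have "exp (\<i> * of_real \<theta>) * (exp (- \<i> * of_real \<theta>) * w) = w"
    by (simp only: mult.assoc[symmetric] mult_1)
  moreover have "cmod (exp (- \<i> * of_real \<theta>)) = 1" by simp
  ultimately show ?thesis by (simp only: rotation_def norm_mult mult_1)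
qed

theorem theorem2p9:
  fixes \<alpha> :: real
  assumes "0 < \<alpha>" and "\<alpha> \<le> 1"
  shows "(\<forall>f \<in> class_W0 \<alpha>. \<forall>z \<in> unit_disc.
            growth_lower \<alpha> (cmod z) \<le> cmod (f z) \<and> cmod (f z) \<le> growth_upper \<alpha> (cmod z)) \<and>
         (\<forall>\<theta>::real. rotation \<theta> (extremal \<alpha>) \<in> class_W0 \<alpha> \<and>
            (\<forall>r \<in> {0..<1}.
               (\<exists>z. cmod z = r \<and> cmod (rotation \<theta> (extremal \<alpha>) z) = growth_lower \<alpha> r) \<and>
               (\<exists>z. cmod z = r \<and> cmod (rotation \<theta> (extremal \<alpha>) z) = growth_upper \<alpha> r)))"
proof (intro conjI ballI allI)
  fix f z assume "f \<in> class_W0 \<alpha>" "z \<in> unit_disc"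
  then show "growth_lower \<alpha> (cmod z) \<le> cmod (f z)" "cmod (f z) \<le> growth_upper \<alpha> (cmod z)"
    using W0_growth[OF assms(1)] by auto
next
  fix \<theta> show "rotation \<theta> (extremal \<alpha>) \<in> class_W0 \<alpha>"
    by (rule rotation_extremal_in_W0[OF assms(1)])
next
  fix \<theta> r :: real assume "r \<in> {0..<1}"
  then have r: "0 \<le> r" "r < 1" by auto
  let ?e = "exp (- \<i> * of_real \<theta>)"
  have e: "cmod (?e * w) = cmod w" for w by (simp add: norm_mult)
  have "cmod (extremal \<alpha> (- of_real r)) = cmod (of_real (growth_lower \<alpha> r))"
    using growth_lower_eq[OF assms(1), of r] r by simp
  then have "cmod (extremal \<alpha> (- of_real r)) = growth_lower \<alpha> r"
    using growth_lower_nonneg[OF assms(1) r] by simp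
  then show "\<exists>z. cmod z = r \<and> cmod (rotation \<theta> (extremal \<alpha>) z) = growth_lower \<alpha> r"
    using r by (intro exI[of _ "?e * - of_real r"]) (simp only: rotation_at_back_rotated e, simp)
  \<comment> \<open>The upper bound dominates the modulus of a class member at the point r, hence is
    nonnegative.\<close>
  have "growth_upper \<alpha> r \<ge> 0"
    using W0_growth(2)[OF assms(1) rotation_extremal_in_W0[OF assms(1)], of "of_real r" \<theta>] r
    by (simp add: order_trans[OF norm_ge_zero])
  moreover have "cmod (extremal \<alpha> (of_real r)) = cmod (of_real (growth_upper \<alpha> r))"
    using growth_upper_eq[OF assms(1), of r] r by simp
  ultimately have "cmod (extremal \<alpha> (of_real r)) = growth_upper \<alpha> r" by simp
  then show "\<exists>z. cmod z = r \<and> cmod (rotation \<theta> (extremal \<alpha>) z) = growth_upper \<alpha> r"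
    using r by (intro exI[of _ "?e * of_real r"]) (simp only: rotation_at_back_rotated e, simp)
qed

end
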